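(* Let $n\ge 1$ and let $A_0,A_1,\ldots,A_n$ be independent and identically distributed $\mathrm{N}(0,1)$ random variables. Consider the random linear homogeneous differential equation $A_nx^{(n)}+A_{n-1}x^{(n-1)}+\cdots+A_1x'+A_0x=0$, let $X$ be the number of roots with negative real part, counted with multiplicity, of its characteristic polynomial $Q(\lambda)=A_n\lambda^n+A_{n-1}\lambda^{n-1}+\cdots+A_1\lambda+A_0$, and set $p_k=P(X=k)$ for $k=0,1,\ldots,n$. Then $E(X)=\frac n2$, and the following hold. (a) If $n$ is odd, then $2\sum_{k=0}^{(n-1)/2}p_k=1$. In particular, when $n=1$, $p_0=p_1=\frac12$. (b) If $n$ is even, then $2\sum_{k=0}^{n/2-1}p_k+p_{n/2}=1$. (c) If $n$ is even and $\frac n2$ is even, then $$2\sum_{\substack{0\le k\le n/2-2\\ k\text{ even}}}p_k+p_{n/2}=\frac12\quad\text{and}\quad 2\sum_{\substack{1\le k\le n/2-1\\ k\text{ odd}}}p_k=\frac12.$$ In particular, when $n=4$, $p_1=p_3=\frac14$, $p_2=\frac12-2p_0$ and $p_4=p_0$. (d) If $n$ is even and $\frac n2$ is odd, then $$2\sum_{\substack{0\le k\le n/2-1\\ k\text{ even}}}p_k=\frac12\quad\text{and}\quad 2\sum_{\substack{1\le k\le n/2-2\\ k\text{ odd}}}p_k+p_{n/2}=\frac12.$$ In particular, when $n=2$, $p_0=p_2=\frac14$ and $p_1=\frac12$.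
   Context: Since $A_n\neq0$ almost surely, $Q$ has degree $n$ almost surely. Empty sums are zero. *)

theory Defs
  imports "HOL-Probability.Probability"
    "HOL-Computational_Algebra.Computational_Algebra"
begin

text \<open>
  Characteristic polynomial of
  \<open>(\<Sum>i\<le>n. a i * x^(i)) = 0\<close>, where \<open>x^(i)\<close> is the \<open>i\<close>-th derivative, taken over the complex
  numbers so that all its roots are available.
\<close>

definition characteristic_poly :: "nat \<Rightarrow> (nat \<Rightarrow> real) \<Rightarrow> complex poly" where
  "characteristic_poly n a = (\<Sum>i\<le>n. monom (complex_of_real (a i)) i)"

text \<open>
  The multiset \<open>proots Q\<close> holds each root of \<open>Q\<close> with its multiplicity. It is empty for
  \<open>Q = 0\<close>, so the count below is then \<open>0\<close>.
\<close>

definition num_roots_neg_Re :: "complex poly \<Rightarrow> nat" where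
  "num_roots_neg_Re Q = size {# z \<in># proots Q. Re z < 0 #}"

end

theory Submission
  imports Defs
begin

text \<open>
  The law of the coefficients is invariant under sign changes of individual coefficients.
  Replacing \<open>A i\<close> by \<open>(-1)^i * A i\<close> reflects the roots, and almost surely no root is purely
  imaginary, so \<open>X\<close> and \<open>n - X\<close> have the same law. Since nonreal roots come in conjugate pairs,
  the sign of \<open>A 0 * A n\<close> is \<open>(-1)^(n - X)\<close>, so flipping the sign of \<open>A 0\<close> shows that \<open>X\<close> is even
  with probability \<open>1/2\<close>. That almost surely no root is imaginary follows from Fubini's theorem:
  for fixed \<open>A 1, \<dots>, A n\<close>, only finitely many values of \<open>A 0\<close> allow one.
\<close>

section \<open>Coefficients, values and degree of the characteristic polynomial\<close>

lemma coeff_characteristic_poly: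
  "coeff (characteristic_poly n a) j = (if j \<le> n then complex_of_real (a j) else 0)"
  by (simp add: characteristic_poly_def coeff_sum if_distrib sum.delta cong: if_cong)

lemma poly_characteristic_poly:
  "poly (characteristic_poly n a) z = (\<Sum>i\<le>n. complex_of_real (a i) * z ^ i)"
  by (simp add: characteristic_poly_def poly_sum poly_monom)

lemma characteristic_poly_cong:
  "(\<And>i. i \<le> n \<Longrightarrow> a i = b i) \<Longrightarrow> characteristic_poly n a = characteristic_poly n b"
  by (simp add: characteristic_poly_def)

lemma degree_characteristic_poly: "a n \<noteq> 0 \<Longrightarrow> degree (characteristic_poly n a) = n"
  by (intro antisym degree_le le_degree) (auto simp: coeff_characteristic_poly)

lemma lead_coeff_characteristic_poly:
  "a n \<noteq> 0 \<Longrightarrow> lead_coeff (characteristic_poly n a) = complex_of_real (a n)"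
  by (simp add: degree_characteristic_poly coeff_characteristic_poly)

lemma num_roots_neg_Re_le_degree: "num_roots_neg_Re Q \<le> degree Q"
  unfolding num_roots_neg_Re_def
  by (metis size_filter_mset_lesseq size_proots_complex)

section \<open>Root multisets and the reflection of roots at the origin\<close>

text \<open>Roots of a product add up and a nonzero scalar adds none. Every root multiset below is
  read off from an explicit factorisation in this way, so multiplicities are tracked
  automatically.\<close>

lemma proots_split_linear:
  fixes c :: "'a :: idom"
  assumes "c \<noteq> 0"
  shows "proots (smult c (\<Prod>x\<in>#B. [:- x, 1:])) = B"
proof -
  have "proots (\<Prod>x\<in>#B. [:- x, 1:]) = B"
  proof (induction B)
    case (add x B)
    have "(\<Prod>x\<in>#B. [:- x, 1:]) \<noteq> 0" by (auto simp: prod_mset_zero_iff)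
    then show ?case using add
      by (simp del: mult_pCons_left add: proots_mult)
  qed simp
  then show ?thesis using assms by simp
qed

lemma pcompose_uminus_split_linear:
  "pcompose (\<Prod>x\<in>#B. [:- x, 1:]) [:0, -1 :: complex:] =
    smult ((-1) ^ size B) (\<Prod>x\<in>#image_mset uminus B. [:- x, 1:])"
  by (rule poly_ext, induction B) (simp_all add: poly_pcompose algebra_simps)

text \<open>Putting \<open>-z\<close> into a linear factor with root \<open>x\<close> gives
  \<open>-1\<close> times the factor with root \<open>-x\<close>. The \<open>degree p\<close> signs
  collect into the nonzero constant \<open>(-1) ^ degree p\<close>.\<close>

lemma proots_pcompose_uminus:
  "proots (pcompose p [:0, -1:]) = image_mset uminus (proots (p :: complex poly))"
proof (cases "p = 0")
  case False
  have *: "pcompose p [:0, -1:] = smult (lead_coeff p * (-1) ^ degree p)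
      (\<Prod>x\<in>#image_mset uminus (proots p). [:- x, 1:])"
    by (subst (1) complex_poly_decompose_multiset [of p, symmetric])
       (simp only: pcompose_smult pcompose_uminus_split_linear size_proots_complex smult_smult)
  show ?thesis unfolding * using False by (intro proots_split_linear) simp
qed simp

lemma characteristic_poly_reflect:
  "characteristic_poly n (\<lambda>i. (-1) ^ i * a i) = pcompose (characteristic_poly n a) [:0, -1:]"
proof (rule poly_ext)
  fix z :: complex
  show "poly (characteristic_poly n (\<lambda>i. (-1) ^ i * a i)) z =
      poly (pcompose (characteristic_poly n a) [:0, -1:]) z"
    by (simp add: poly_pcompose poly_characteristic_poly power_minus [of z] mult_ac)
qed

lemma num_roots_neg_Re_reflect:
  "num_roots_neg_Re (characteristic_poly n (\<lambda>i. (-1) ^ i * a i)) =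
    size {#z \<in># proots (characteristic_poly n a). Re z > 0#}"
  unfolding num_roots_neg_Re_def characteristic_poly_reflect proots_pcompose_uminus
  by (simp add: filter_mset_image_mset)

text \<open>Negation exchanges the two open half planes, so the second summand counts the roots with
  positive real part. Without imaginary roots, each of the \<open>n\<close> roots falls under
  exactly one of the two counts.\<close>

lemma num_roots_neg_Re_add_reflect:
  assumes "a n \<noteq> 0" and "\<And>z. poly (characteristic_poly n a) z = 0 \<Longrightarrow> Re z \<noteq> 0"
  shows "num_roots_neg_Re (characteristic_poly n a) +
    num_roots_neg_Re (characteristic_poly n (\<lambda>i. (-1) ^ i * a i)) = n"
proof -
  let ?p = "characteristic_poly n a"
  let ?R = "proots ?p"
  have "?p \<noteq> 0" using lead_coeff_characteristic_poly [of a n] assms(1) by auto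
  have "{#z \<in># ?R. Re z > 0#} = {#z \<in># ?R. \<not> Re z < 0#}"
    using assms(2) \<open>?p \<noteq> 0\<close> by (intro filter_mset_cong) (auto simp: not_less le_less)
  moreover have "size ?R = size {#z \<in># ?R. Re z < 0#} + size {#z \<in># ?R. \<not> Re z < 0#}"
    by (metis multiset_partition size_union)
  ultimately show ?thesis using size_proots_complex [of "characteristic_poly n a"] assms(1)
    unfolding num_roots_neg_Re_reflect
    by (simp add: num_roots_neg_Re_def degree_characteristic_poly)
qed

section \<open>Conjugate pairs and the sign of the constant coefficient\<close>

text \<open>Conjugating the coefficients conjugates every linear factor, but real coefficients stay
  fixed. Comparing whole factorisations gives equality of multiplicities as well.\<close>

lemma image_mset_cnj_proots:
  "image_mset cnj (proots (characteristic_poly n a)) = proots (characteristic_poly n a)"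
proof (rule multiset_eqI)
  fix z
  let ?p = "characteristic_poly n a"
  have "image_mset cnj (proots ?p) = proots (map_poly cnj ?p)"
  proof (cases "?p = 0")
    case False
    have *: "map_poly cnj (\<Prod>x\<in>#B. [:- x, 1:]) = (\<Prod>x\<in>#image_mset cnj B. [:- x, 1:])" for B
      by (rule poly_ext, induction B)
         simp_all
    have "map_poly cnj ?p = map_poly cnj (smult (lead_coeff ?p) (\<Prod>x\<in>#proots ?p. [:- x, 1:]))"
      by (simp add: complex_poly_decompose_multiset)
    also have "\<dots> = smult (cnj (lead_coeff ?p)) (\<Prod>x\<in>#image_mset cnj (proots ?p). [:- x, 1:])"
      unfolding * [symmetric] by (intro poly_eqI) (simp add: coeff_map_poly)
    finally have **: "map_poly cnj ?p = \<dots>" .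
    show ?thesis unfolding ** using False by (intro proots_split_linear [symmetric]) simp
  qed simp
  also have "map_poly cnj ?p = ?p"
    by (intro poly_eqI) (simp add: coeff_map_poly coeff_characteristic_poly)
  finally show "count (image_mset cnj (proots ?p)) z = count (proots ?p) z" by simp
qed

text \<open>Induction removes one real element or one conjugate pair. A real \<open>z\<close>
  contributes \<open>-z\<close>, negative exactly when \<open>z\<close> is counted. A pair
  contributes the positive factor \<open>(cmod z)\<^sup>2\<close> and changes the count by 0 or 2,
  hence not its parity.\<close>

lemma prod_uminus_cnj_closed:
  assumes "image_mset cnj B = B" and "0 \<notin># B"
  shows "\<exists>r>0. (\<Prod>z\<in>#B. - z) = complex_of_real (r * (-1) ^ size {#z \<in># B. Re z > 0#})"
  using assms
proof (induction B rule: measure_induct_rule [where f = size])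
  case (less B)
  show ?case
  proof (cases "B = {#}")
    case True
    then show ?thesis by (auto intro!: exI [of _ 1])
  next
    case False
    then obtain z where z: "z \<in># B" by auto
    then obtain C where C: "B = add_mset z C" by (metis multi_member_split)
    show ?thesis
    proof (cases "cnj z = z")
      case True
      then have "image_mset cnj C = C" using less.prems(1) C by simp
      then obtain r where r: "r > 0"
        "(\<Prod>z\<in>#C. - z) = complex_of_real (r * (-1) ^ size {#z \<in># C. Re z > 0#})"
        using less.IH [of C] less.prems C by auto
      have z': "z = complex_of_real (Re z)" using True by (simp add: complex_eq_iff)
      then have "Re z \<noteq> 0" using less.prems(2) z by (metis of_real_0)
      with r show ?thesis unfolding C
        by (intro exI [of _ "\<bar>Re z\<bar> * r"]) (subst z', auto simp: z' [symmetric] abs_if)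
    next
      case False
      have "cnj z \<in># B" using z less.prems(1) by (metis image_eqI set_image_mset)
      with False C obtain D where D: "B = add_mset z (add_mset (cnj z) D)"
        by (metis insert_noteq_member multi_member_split)
      then have "image_mset cnj D = D" using less.prems(1)
        by (simp add: add_mset_commute [of z])
      then obtain r where r: "r > 0"
        "(\<Prod>z\<in>#D. - z) = complex_of_real (r * (-1) ^ size {#z \<in># D. Re z > 0#})"
        using less.IH [of D] less.prems D by auto
      have "z \<noteq> 0" using less.prems(2) z by auto
      have *: "(\<Prod>z\<in>#B. - z) = (z * cnj z) * (\<Prod>z\<in>#D. - z)" by (simp add: D)
      show ?thesis unfolding * complex_norm_square [symmetric]
        using r \<open>z \<noteq> 0\<close> by (intro exI [of _ "(cmod z)\<^sup>2 * r"]) (auto simp: D)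
    qed
  qed
qed

text \<open>By Vieta, \<open>a 0\<close> is \<open>a n\<close> times the product of the negated
  roots, so the sign of \<open>a 0 * a n\<close> is the parity of the number of roots in the right
  half plane. Imaginary roots are harmless here: they occur in uncounted pairs with positive
  product.\<close>

lemma constant_coeff_sign:
  assumes "a n \<noteq> 0" "a 0 \<noteq> 0"
  shows "a 0 * a n > 0 \<longleftrightarrow>
    even (num_roots_neg_Re (characteristic_poly n (\<lambda>i. (-1) ^ i * a i)))"
proof -
  let ?p = "characteristic_poly n a"
  have p0: "poly ?p 0 = of_real (a 0)"
    by (simp add: poly_0_coeff_0 coeff_characteristic_poly)
  have "poly ?p 0 = of_real (a n) * (\<Prod>z\<in>#proots ?p. - z)"
  proof -
    have *: "poly (\<Prod>x\<in>#B. [:- x, 1:]) 0 = (\<Prod>z\<in>#B. - z)" for B :: "complex multiset"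
      by (induction B) simp_all
    show ?thesis
      by (subst complex_poly_decompose_multiset [of ?p, symmetric])
         (simp only: poly_smult * lead_coeff_characteristic_poly [of a, OF assms(1)])
  qed
  moreover obtain r where r: "r > 0"
    "(\<Prod>z\<in>#proots ?p. - z) = complex_of_real (r * (-1) ^ size {#z \<in># proots ?p. Re z > 0#})"
  proof -
    have "?p \<noteq> 0" using p0 assms(2) by auto
    then have "0 \<notin># proots ?p" using p0 assms(2) by simp
    then show ?thesis
      using prod_uminus_cnj_closed [OF image_mset_cnj_proots] that by blast
  qed
  ultimately have "complex_of_real (a 0) =
      of_real (a n * (r * (-1) ^ size {#z \<in># proots ?p. Re z > 0#}))"
    using p0 by simp
  then have "a 0 = a n * (r * (-1) ^ size {#z \<in># proots ?p. Re z > 0#})"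
    by (simp only: of_real_eq_iff)
  then have "a 0 * a n = (a n)\<^sup>2 * r * (-1) ^ size {#z \<in># proots ?p. Re z > 0#}"
    by (simp add: power2_eq_square)
  moreover have "(a n)\<^sup>2 * r > 0" using r(1) assms by simp
  ultimately show ?thesis unfolding num_roots_neg_Re_reflect
    by (cases "even (size {#z \<in># proots ?p. Re z > 0#})") (auto simp del: zero_less_mult_iff)
qed

section \<open>Finiteness of the constant coefficients that allow an imaginary root\<close>

text \<open>
  An imaginary root \<open>z\<close> of \<open>Q\<close> comes with the root \<open>cnj z = - z\<close>, so it is a root of
  \<open>Q(z) - Q(-z)\<close>, which does not involve the constant coefficient.
\<close>

lemma finite_constant_coeff_imaginary_root:
  assumes "n \<ge> 1" "a 1 \<noteq> 0"
  shows "finite {y. \<exists>z. poly (characteristic_poly n (a(0 := y))) z = 0 \<and> Re z = 0}"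
proof -
  \<comment> \<open>\<open>D\<close> represents Q(z) - Q(-z): even coefficients cancel and odd ones
    double. Its linear coefficient \<open>2 * a 1\<close> is nonzero, so \<open>D\<close> has
    finitely many roots.\<close>
  define D where "D = characteristic_poly n (\<lambda>i. a i * (1 - (-1) ^ i))"
  have "coeff D 1 \<noteq> 0" using assms by (simp add: D_def coeff_characteristic_poly)
  then have "D \<noteq> 0" by auto
  then have fin: "finite {z. poly D z = 0}" by (rule poly_roots_finite)
  have split: "poly (characteristic_poly n (a(0 := y))) z =
      of_real y + poly (characteristic_poly n (a(0 := 0))) z" for y z
    using sum.remove [of "{..n}" 0 "\<lambda>i. complex_of_real ((a(0 := y)) i) * z ^ i"]
      sum.remove [of "{..n}" 0 "\<lambda>i. complex_of_real ((a(0 := 0)) i) * z ^ i"]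
    by (simp add: poly_characteristic_poly)
  \<comment> \<open>A root \<open>z\<close> determines the constant coefficient, since
    \<open>y\<close> is minus the value at \<open>z\<close> of the remaining terms. Finitely many
    \<open>z\<close> therefore leave finitely many \<open>y\<close>.\<close>
  have "{y. \<exists>z. poly (characteristic_poly n (a(0 := y))) z = 0 \<and> Re z = 0} \<subseteq>
      (\<lambda>z. - Re (poly (characteristic_poly n (a(0 := 0))) z)) ` {z. poly D z = 0}"
  proof safe
    fix y z assume z: "poly (characteristic_poly n (a(0 := y))) z = 0" "Re z = 0"
    have "cnj z = - z" using z(2) by (simp add: complex_eq_iff)
    have "poly (characteristic_poly n (a(0 := y))) (- z) = cnj (poly (characteristic_poly n (a(0 := y))) z)"
      by (simp add: poly_characteristic_poly \<open>cnj z = - z\<close>)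
    then have "poly (characteristic_poly n (a(0 := y))) z - poly (characteristic_poly n (a(0 := y))) (- z) = 0"
      using z by simp
    also have "poly (characteristic_poly n (a(0 := y))) z - poly (characteristic_poly n (a(0 := y))) (- z) = poly D z"
      unfolding D_def poly_characteristic_poly sum_subtractf [symmetric]
      by (intro sum.cong) (auto simp: algebra_simps power_minus [of z])
    finally have "poly D z = 0" .
    moreover have "of_real y + poly (characteristic_poly n (a(0 := 0))) z = 0"
      using z(1) split [of y z] by argo
    then have "y = - Re (poly (characteristic_poly n (a(0 := 0))) z)"
      by (auto simp: complex_eq_iff)
    ultimately show "y \<in> (\<lambda>z. - Re (poly (characteristic_poly n (a(0 := 0))) z)) ` {z. poly D z = 0}"
      by blast
  qed
  then show ?thesis using fin by (meson finite_imageI finite_subset)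
qed

section \<open>Borel measurability of the root count\<close>

text \<open>Each further linear factor gives coefficient \<open>j\<close> as the old coefficient
  \<open>j - 1\<close> minus \<open>z n\<close> times the old coefficient \<open>j\<close>, with 0
  in place of the former when \<open>j = 0\<close>.\<close>

lemma continuous_on_coeff_prod_linear:
  "continuous_on UNIV (\<lambda>z :: nat \<Rightarrow> complex. coeff (\<Prod>i<n. [:- z i, 1:]) j)"
proof (induction n arbitrary: j)
  case (Suc n)
  have "coeff (\<Prod>i<Suc n. [:- z i, 1:]) j =
      (case j of 0 \<Rightarrow> 0 | Suc l \<Rightarrow> coeff (\<Prod>i<n. [:- z i, 1:]) l) -
      z n * coeff (\<Prod>i<n. [:- z i, 1:]) j" for z :: "nat \<Rightarrow> complex"
    by (simp add: mult.commute [of _ "[:- z n, 1:]"] coeff_pCons split: nat.split)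
  then show ?case
    by (cases j) (auto intro!: continuous_intros Suc.IH)
qed simp

text \<open>Tychonoff's theorem, transferred from \<open>product_topology\<close> to the type class
  topology on functions.\<close>

lemma compact_Pi_UNIV:
  fixes K :: "'i \<Rightarrow> 'b :: topological_space set"
  assumes "\<And>i. compact (K i)"
  shows "compact (Pi UNIV K)"
proof -
  have "compactin (product_topology (\<lambda>i. euclidean) UNIV) (PiE UNIV K)"
    using assms by (simp add: compactin_PiE compactin_euclidean_iff)
  then show ?thesis by (simp add: euclidean_product_topology compactin_euclidean_iff PiE_UNIV_domain)
qed

text \<open>
  A vector \<open>z\<close> encodes a polynomial of degree \<open>n\<close>: its roots are \<open>z 0, \<dots>, z (n - 1)\<close>, the first
  \<open>k\<close> of them in the open left half plane, and \<open>z n\<close> is the leading coefficient.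
\<close>

definition root_box :: "nat \<Rightarrow> nat \<Rightarrow> nat \<Rightarrow> complex set" where
  "root_box n k i =
    (if i < k then {z. Re z < 0} else if i < n then UNIV else if i = n then - {0} else {0})"

text \<open>Listing the roots with those in the left half plane first puts at least \<open>k\<close>
  such roots into the first \<open>k\<close> slots. Conversely, the factorisation displays the root
  multiset. This describes the count through the map from roots to coefficients.\<close>

lemma le_num_roots_neg_Re_iff:
  assumes "a n \<noteq> 0" "k \<le> n"
  shows "k \<le> num_roots_neg_Re (characteristic_poly n a) \<longleftrightarrow>
    (\<exists>z \<in> Pi UNIV (root_box n k). characteristic_poly n a = smult (z n) (\<Prod>i<n. [:- z i, 1:]))"
    (is "?L \<longleftrightarrow> ?R")
proof
  let ?Q = "characteristic_poly n a"
  assume ?L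
  obtain xs where xs: "mset xs = {#z \<in># proots ?Q. Re z < 0#}" using ex_mset by blast
  obtain ys where ys: "mset ys = {#z \<in># proots ?Q. \<not> Re z < 0#}" using ex_mset by blast
  have len: "k \<le> length xs"
    using \<open>?L\<close> unfolding num_roots_neg_Re_def xs [symmetric] by simp
  have ms: "mset (xs @ ys) = proots ?Q" by (simp add: xs ys)
  then have "length (xs @ ys) = n"
    by (metis size_mset size_proots_complex degree_characteristic_poly [of a, OF assms(1)])
  define z where "z i = (if i < n then (xs @ ys) ! i else if i = n then complex_of_real (a n) else 0)" for i
  have neg: "Re (xs ! i) < 0" if "i < length xs" for i
    using nth_mem_mset [OF that] unfolding xs by simp
  have "z i \<in> root_box n k i" for i
    using len \<open>length (xs @ ys) = n\<close> assms neg [of i]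
    by (auto simp: z_def root_box_def nth_append)
  moreover have "?Q = smult (z n) (\<Prod>i<n. [:- z i, 1:])"
  proof -
    have "(\<Prod>i<n. [:- z i, 1:]) = (\<Prod>i<n. [:- ((xs @ ys) ! i), 1:])"
      by (intro prod.cong) (auto simp: z_def)
    also have "\<dots> = (\<Prod>x\<leftarrow>xs @ ys. [:- x, 1:])"
      using \<open>length (xs @ ys) = n\<close> 
      by (subst prod.list_conv_set_nth)
         (auto simp: atLeast0LessThan simp del: map_append intro!: prod.cong)
    also have "\<dots> = (\<Prod>x\<in>#proots ?Q. [:- x, 1:])"
      unfolding ms [symmetric] mset_map [symmetric] prod_mset_prod_list ..
    finally show ?thesis
      using complex_poly_decompose_multiset [of ?Q] lead_coeff_characteristic_poly [of a n] assms
      by (simp add: z_def)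
  qed
  ultimately show ?R by blast
next
  let ?Q = "characteristic_poly n a"
  assume ?R
  then obtain z where z: "\<And>i. z i \<in> root_box n k i"
    and Q: "?Q = smult (z n) (\<Prod>i<n. [:- z i, 1:])" by auto
  have "z n \<noteq> 0" using z [of n] assms by (auto simp: root_box_def)
  have "(\<Prod>i<n. [:- z i, 1:]) = (\<Prod>x\<in>#image_mset z (mset_set {..<n}). [:- x, 1:])"
    by (simp add: prod_unfold_prod_mset image_mset.compositionality comp_def)
  then have "proots ?Q = image_mset z (mset_set {..<n})"
    unfolding Q using proots_split_linear [OF \<open>z n \<noteq> 0\<close>] by metis
  then have "num_roots_neg_Re ?Q = card {i \<in> {..<n}. Re (z i) < 0}"
    by (simp add: num_roots_neg_Re_def filter_mset_image_mset)
  moreover have "{..<k} \<subseteq> {i \<in> {..<n}. Re (z i) < 0}"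
  proof
    fix i assume "i \<in> {..<k}"
    then show "i \<in> {i \<in> {..<n}. Re (z i) < 0}"
      using assms z [of i] by (auto simp: root_box_def)
  qed
  then have "k \<le> card {i \<in> {..<n}. Re (z i) < 0}" by (metis card_lessThan card_mono finite_Collect_conjI finite_lessThan Collect_mem_eq)
  ultimately show ?L by simp
qed

text \<open>The eventual membership in the third property, rather than membership at some stage,
  lets finitely many coordinates share a common stage \<open>m\<close>.\<close>

lemma root_box_exhaustion:
  obtains C where "\<And>i m. compact (C i m)" "\<And>i m. C i m \<subseteq> root_box n k i"
    "\<And>i z. z \<in> root_box n k i \<Longrightarrow> \<forall>\<^sub>F m in sequentially. z \<in> C i m"
    "\<And>i m. i > n \<Longrightarrow> i \<ge> k \<Longrightarrow> C i m = {0}"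
proof -
  have "\<exists>C. (\<forall>m. compact (C m)) \<and> (\<forall>m. C m \<subseteq> root_box n k i) \<and>
      (\<forall>z \<in> root_box n k i. \<forall>\<^sub>F m in sequentially. z \<in> C m) \<and> (i > n \<longrightarrow> i \<ge> k \<longrightarrow> (\<forall>m. C m = {0}))" for i
  \<comment> \<open>In the first case the box is the point 0 and a constant sequence serves.
    Otherwise it is open, hence exhausted by compact sets.\<close>
  proof (cases "i > n \<and> i \<ge> k")
    case True
    then show ?thesis by (intro exI [of _ "\<lambda>_. {0}"]) (auto simp: root_box_def)
  next
    case False
    then have "open (root_box n k i)"
      by (auto simp: root_box_def open_halfspace_Re_lt)
    then obtain C where C: "\<And>m. compact (C m)" "\<And>m. C m \<subseteq> root_box n k i"
      "\<And>K. compact K \<Longrightarrow> K \<subseteq> root_box n k i \<Longrightarrow> \<exists>N::nat. \<forall>m\<ge>N. K \<subseteq> C m"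
      by (metis open_Union_compact_subsets)
    have "\<forall>\<^sub>F m in sequentially. z \<in> C m" if "z \<in> root_box n k i" for z
      using C(3) [of "{z}"] that by (auto simp: eventually_sequentially)
    with C False show ?thesis by (intro exI [of _ C]) auto
  qed
  then obtain C where "\<And>i. (\<forall>m. compact (C i m)) \<and> (\<forall>m. C i m \<subseteq> root_box n k i) \<and>
      (\<forall>z \<in> root_box n k i. \<forall>\<^sub>F m in sequentially. z \<in> C i m) \<and> (i > n \<longrightarrow> i \<ge> k \<longrightarrow> (\<forall>m. C i m = {0}))"
    by metis
  then show ?thesis by (intro that [of C]) auto
qed

text \<open>
  The coefficient vectors with a given number of roots in the open left half plane form a
  \<open>\<sigma>\<close>-compact set, as a continuous image of a \<open>\<sigma>\<close>-compact set of roots. This replaces the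
  continuity of the roots in the coefficients.
\<close>

lemma sets_le_num_roots_neg_Re:
  assumes "k \<le> n"
  shows "{a. a n \<noteq> 0 \<and> k \<le> num_roots_neg_Re (characteristic_poly n a)} \<in> sets borel"
proof -
  obtain C where C: "\<And>i m. compact (C i m)" "\<And>i m. C i m \<subseteq> root_box n k i"
    "\<And>i z. z \<in> root_box n k i \<Longrightarrow> \<forall>\<^sub>F m in sequentially. z \<in> C i m"
    "\<And>i m. i > n \<Longrightarrow> i \<ge> k \<Longrightarrow> C i m = {0}"
    using root_box_exhaustion [of n k] by metis
  define G where "G z = coeff (smult (z n) (\<Prod>i<n. [:- z i, 1:]))" for z :: "nat \<Rightarrow> complex"
  have exh: "Pi UNIV (root_box n k) = (\<Union>m. Pi UNIV (\<lambda>i. C i m))"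
  proof
    show "Pi UNIV (root_box n k) \<subseteq> (\<Union>m. Pi UNIV (\<lambda>i. C i m))"
    proof
      fix z assume z: "z \<in> Pi UNIV (root_box n k)"
      \<comment> \<open>The finitely many indices up to \<open>n\<close> share one stage
        \<open>m\<close>. Beyond \<open>n\<close> every stage is \<open>{0}\<close>, which contains
        the only value that the box allows.\<close>
      then have "\<forall>\<^sub>F m in sequentially. \<forall>i\<in>{..n}. z i \<in> C i m"
        by (intro eventually_ball_finite) (auto intro: C(3))
      then obtain m where m: "\<And>i. i \<le> n \<Longrightarrow> z i \<in> C i m"
        by (auto simp: eventually_sequentially)
      have "z i \<in> C i m" if "i > n" for i
      proof -
        have "z i \<in> root_box n k i" using z by blast
        then show ?thesis using that assms C(4) [of i m] by (auto simp: root_box_def)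
      qed
      with m show "z \<in> (\<Union>m. Pi UNIV (\<lambda>i. C i m))" using not_less by blast
    qed
  qed (use C(2) in blast)
  have "continuous_on UNIV G"
    unfolding G_def coeff_smult
    by (intro continuous_on_coordinatewise_then_product continuous_on_mult
        continuous_on_coeff_prod_linear continuous_on_product_coordinates)
  then have "closed (G ` Pi UNIV (\<lambda>i. C i m))" for m
    \<comment> \<open>Compact images under \<open>G\<close> are closed. Their preimages under the
      coefficient map are closed too, and the countable union over \<open>m\<close> is
      Borel.\<close>
    using C(1) by (intro compact_imp_closed compact_continuous_image compact_Pi_UNIV)
      (auto intro: continuous_on_subset)
  moreover have cont: "continuous_on UNIV (\<lambda>a. coeff (characteristic_poly n a))"
    unfolding coeff_characteristic_poly
  proof (rule continuous_on_coordinatewise_then_product)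
    show "continuous_on UNIV (\<lambda>a :: nat \<Rightarrow> real. if i \<le> n then complex_of_real (a i) else 0)" for i
      by (cases "i \<le> n") (auto intro!: continuous_intros)
  qed
  ultimately have "closed ((\<lambda>a. coeff (characteristic_poly n a)) -` (G ` Pi UNIV (\<lambda>i. C i m)))" for m
    by (intro continuous_closed_vimage) (auto simp: continuous_on_eq_continuous_at)
  moreover have "open {a :: nat \<Rightarrow> real. a n \<noteq> 0}"
    by (intro open_Collect_neq) (auto intro: continuous_intros)
  ultimately have "{a. a n \<noteq> 0} \<inter>
      (\<Union>m. (\<lambda>a. coeff (characteristic_poly n a)) -` (G ` Pi UNIV (\<lambda>i. C i m))) \<in> sets borel"
    by auto
  also have "(\<Union>m. (\<lambda>a. coeff (characteristic_poly n a)) -` (G ` Pi UNIV (\<lambda>i. C i m))) =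
      {a. \<exists>z \<in> Pi UNIV (root_box n k). coeff (characteristic_poly n a) = G z}"
    unfolding exh by blast
  also have "\<dots> = {a. \<exists>z \<in> Pi UNIV (root_box n k).
      characteristic_poly n a = smult (z n) (\<Prod>i<n. [:- z i, 1:])}"
    by (simp only: G_def coeff_inject)
  also have "{a. a n \<noteq> 0} \<inter> \<dots> = {a. a n \<noteq> 0 \<and> k \<le> num_roots_neg_Re (characteristic_poly n a)}"
    by (intro set_eqI) (simp add: le_num_roots_neg_Re_iff [OF _ assms] cong: conj_cong)
  finally show ?thesis .
qed

text \<open>Borel superlevel sets are available so far only where the leading coefficient is
  nonzero. Where \<open>a (Suc n)\<close> vanishes, the polynomial is the one for \<open>n\<close>,
  which is handled by induction.\<close>

lemma measurable_num_roots_neg_Re: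
  "(\<lambda>a. num_roots_neg_Re (characteristic_poly n a)) \<in> borel \<rightarrow>\<^sub>M count_space UNIV"
proof -
  let ?N = "\<lambda>n a. num_roots_neg_Re (characteristic_poly n a)"
  have meas: "{a. k \<le> ?N n a} \<in> sets borel" for k
  proof (induction n)
    case 0
    have "?N 0 a = 0" for a
      using num_roots_neg_Re_le_degree [of "characteristic_poly 0 a"]
      by (simp add: characteristic_poly_def monom_0)
    then show ?case by simp
  next
    case (Suc n)
    have zero: "{a :: nat \<Rightarrow> real. a (Suc n) = 0} \<in> sets borel"
      by (intro borel_closed closed_Collect_eq) (auto intro: continuous_intros)
    have "{a. a (Suc n) \<noteq> 0 \<and> k \<le> ?N (Suc n) a} \<in> sets borel"
    proof (cases "k \<le> Suc n")
      case True
      then show ?thesis by (rule sets_le_num_roots_neg_Re)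
    next
      case False
      have "?N (Suc n) a \<le> Suc n" if "a (Suc n) \<noteq> 0" for a
        using num_roots_neg_Re_le_degree [of "characteristic_poly (Suc n) a"] that
        by (simp add: degree_characteristic_poly)
      with False have "{a. a (Suc n) \<noteq> 0 \<and> k \<le> ?N (Suc n) a} = {}"
        by fastforce
      then show ?thesis by (simp only: sets.empty_sets)
    qed
    then have "{a. a (Suc n) \<noteq> 0 \<and> k \<le> ?N (Suc n) a} \<union>
        ({a. a (Suc n) = 0} \<inter> {a. k \<le> ?N n a}) \<in> sets borel"
      using zero Suc.IH by auto
    also have "{a. a (Suc n) \<noteq> 0 \<and> k \<le> ?N (Suc n) a} \<union>
        ({a. a (Suc n) = 0} \<inter> {a. k \<le> ?N n a}) = {a. k \<le> ?N (Suc n) a}"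
      by (auto simp: characteristic_poly_def)
    finally show ?case .
  qed
  have "?N n -` {k} \<inter> space borel = {a. k \<le> ?N n a} - {a. Suc k \<le> ?N n a}" for k
    by auto
  then show ?thesis using meas by (simp add: measurable_count_space_eq2_countable)
qed

text \<open>Measurability is given only up to index \<open>n\<close>. Setting later coordinates to 0
  keeps the polynomial and makes the whole coefficient vector measurable.\<close>

lemma measurable_num_roots_neg_Re_compose [measurable (raw)]:
  assumes [measurable]: "\<And>i. i \<le> n \<Longrightarrow> f i \<in> borel_measurable M"
  shows "(\<lambda>\<omega>. num_roots_neg_Re (characteristic_poly n (\<lambda>i. f i \<omega>))) \<in> M \<rightarrow>\<^sub>M count_space UNIV"
proof -
  have "(\<lambda>\<omega> i. if i \<le> n then f i \<omega> else 0) \<in> borel_measurable M"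
  proof (rule measurable_coordinatewise_then_product)
    show "(\<lambda>\<omega>. if i \<le> n then f i \<omega> else 0) \<in> borel_measurable M" for i
      by (cases "i \<le> n") simp_all
  qed
  from measurable_compose [OF this measurable_num_roots_neg_Re [of n]]
  show ?thesis
    by (rule back_subst [of "\<lambda>g. g \<in> M \<rightarrow>\<^sub>M count_space UNIV"])
       (auto intro!: arg_cong [of _ _ num_roots_neg_Re] characteristic_poly_cong)
qed

section \<open>The law of the coefficients and almost sure absence of imaginary roots\<close>

lemma AE_std_normal_not_in_finite:
  assumes "finite F"
  shows "AE y in std_normal_distribution. y \<notin> F"
  using AE_not_in [OF finite_imp_null_set_lborel [OF assms]] by (auto simp: AE_density)

text \<open>Independence survives coordinatewise sign changes, and the standard normal law is
  symmetric. The joint law is therefore the same product measure for every choice of signs.\<close>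

lemma (in prob_space) distr_signed_std_normal_family:
  assumes indep: "indep_vars (\<lambda>_. borel) A I" and "I \<noteq> {}"
    and A: "\<And>i. i \<in> I \<Longrightarrow> distributed M lborel (A i) std_normal_density"
    and s: "\<And>i. i \<in> I \<Longrightarrow> \<bar>s i\<bar> = 1"
  shows "distr M (\<Pi>\<^sub>M i\<in>I. borel) (\<lambda>\<omega>. \<lambda>i\<in>I. s i * A i \<omega>) = (\<Pi>\<^sub>M i\<in>I. std_normal_distribution)"
proof -
  have "indep_vars (\<lambda>_. borel) (\<lambda>i \<omega>. s i * A i \<omega>) I"
    using indep_vars_compose2 [OF indep, of "\<lambda>i x. s i * x" "\<lambda>_. borel"] by simp
  moreover have rv: "random_variable borel (\<lambda>\<omega>. s i * A i \<omega>)" if "i \<in> I" for i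
    using distributed_measurable [OF A [OF that]] by simp
  ultimately have "distr M (\<Pi>\<^sub>M i\<in>I. borel) (\<lambda>\<omega>. \<lambda>i\<in>I. s i * A i \<omega>) =
      (\<Pi>\<^sub>M i\<in>I. distr M borel (\<lambda>\<omega>. s i * A i \<omega>))"
    using \<open>I \<noteq> {}\<close> by (subst (asm) indep_vars_iff_distr_eq_PiM') auto
  also have "\<dots> = (\<Pi>\<^sub>M i\<in>I. std_normal_distribution)"
  proof (intro PiM_cong refl)
    fix i assume i: "i \<in> I"
    have "s i \<noteq> 0" using s [OF i] by auto
    then have "distributed M lborel (\<lambda>\<omega>. s i * A i \<omega>) std_normal_density"
      using normal_density_affine [OF A [OF i], of "s i" 0] s [OF i] by simp
    then have "distr M lborel (\<lambda>\<omega>. s i * A i \<omega>) = std_normal_distribution"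
      by (rule distributed_distr_eq_density)
    then show "distr M borel (\<lambda>\<omega>. s i * A i \<omega>) = std_normal_distribution"
      by (simp cong: distr_cong)
  qed
  finally show ?thesis .
qed

lemma AE_no_imaginary_root:
  assumes "n \<ge> 1"
  shows "AE a in (\<Pi>\<^sub>M i\<in>{0..n}. std_normal_distribution).
    a 0 \<noteq> 0 \<and> a n \<noteq> 0 \<and> num_roots_neg_Re (characteristic_poly n a) +
      num_roots_neg_Re (characteristic_poly n (\<lambda>i. (-1) ^ i * a i)) = n"
proof -
  let ?S = "\<lambda>a. num_roots_neg_Re (characteristic_poly n a) +
    num_roots_neg_Re (characteristic_poly n (\<lambda>i. (-1) ^ i * a i))"
  let ?D = "\<Pi>\<^sub>M i\<in>{0..n}. std_normal_distribution"
  interpret product_prob_space "\<lambda>_ :: nat. std_normal_distribution" "{0..n}"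
    by (intro product_prob_spaceI prob_space_normal_density) simp
  \<comment> \<open>The condition \<open>a 1 \<noteq> 0\<close> makes every slice of
    \<open>B\<close> in direction 0 lie in a finite set. The vectors with \<open>a 1 = 0\<close> are
    null and are dealt with by \<open>nz\<close>.\<close>
  define B where "B = {a \<in> space ?D. a 1 \<noteq> 0 \<and> a n \<noteq> 0 \<and> ?S a \<noteq> n}"
  have nz: "AE a in ?D. a i \<noteq> 0" if "i \<le> n" for i
    using that AE_std_normal_not_in_finite [of "{0}"]
    by (intro AE_PiM_component) (auto simp: prob_space_normal_density)
  have [measurable]: "(\<lambda>a. a i) \<in> borel_measurable ?D" if "i \<le> n" for i
    using measurable_component_singleton [of i "{0..n}" "\<lambda>_. std_normal_distribution"] that by simp
  have B: "B \<in> sets ?D"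
    unfolding B_def using assms by measurable
  have ins: "{0..n} = insert 0 {1..n}" by auto
  have "emeasure ?D B = (\<integral>\<^sup>+ a. indicator B a \<partial>?D)" using B by simp
  \<comment> \<open>Fubini with coordinate 0 innermost: it suffices that every slice is
    null.\<close>
  also have "\<dots> = (\<integral>\<^sup>+ x. (\<integral>\<^sup>+ y. indicator B (x(0 := y)) \<partial>std_normal_distribution)
      \<partial>(\<Pi>\<^sub>M i\<in>{1..n}. std_normal_distribution))"
    using B unfolding ins by (intro product_nn_integral_insert) auto
  also have "\<dots> = (\<integral>\<^sup>+ x. 0 \<partial>(\<Pi>\<^sub>M i\<in>{1..n}. std_normal_distribution))"
  proof (rule nn_integral_cong)
    fix x :: "nat \<Rightarrow> real"
    let ?F = "{y. \<exists>z. poly (characteristic_poly n (x(0 := y))) z = 0 \<and> Re z = 0}"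
    have "AE y in std_normal_distribution. x(0 := y) \<notin> B"
    proof (cases "x 1 = 0")
      case True
      then show ?thesis by (simp add: B_def)
    next
      case False
      have "x(0 := y) \<notin> B" if "y \<notin> ?F" for y
        using num_roots_neg_Re_add_reflect [of "x(0 := y)" n] that
        unfolding B_def mem_Collect_eq by blast
      then show ?thesis
        using AE_std_normal_not_in_finite [OF finite_constant_coeff_imaginary_root [of n x, OF assms False]]
        by (auto elim: eventually_mono)
    qed
    then have "(\<integral>\<^sup>+ y. indicator B (x(0 := y)) \<partial>std_normal_distribution) =
        (\<integral>\<^sup>+ y. 0 \<partial>std_normal_distribution)"
      by (intro nn_integral_cong_AE) (auto elim: eventually_mono)
    then show "(\<integral>\<^sup>+ y. indicator B (x(0 := y)) \<partial>std_normal_distribution) = (0 :: ennreal)"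
      by simp
  qed
  finally have "B \<in> null_sets ?D" using B by (auto simp: null_setsI)
  then have "AE a in ?D. a \<notin> B" by (rule AE_not_in)
  with nz [OF le0] nz [OF assms] nz [OF order_refl] show ?thesis
    using AE_space by eventually_elim (auto simp: B_def)
qed

section \<open>Folding symmetric sums and splitting index sets by parity\<close>

text \<open>The bijection \<open>k\<close> to \<open>n - k\<close> carries the indices above
  \<open>n / 2\<close> to those below; only a possible middle index is left over.\<close>

lemma sum_reflection_symmetric:
  fixes p :: "nat \<Rightarrow> real"
  assumes p: "\<And>k. k \<le> n \<Longrightarrow> p (n - k) = p k" and T: "\<And>k. k \<le> n \<Longrightarrow> T (n - k) = T k"
  shows "(\<Sum>k\<in>{k. k \<le> n \<and> T k}. p k) =
    2 * (\<Sum>k\<in>{k. 2 * k < n \<and> T k}. p k) + (\<Sum>k\<in>{k. 2 * k = n \<and> T k}. p k)"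
proof -
  let ?L = "{k. 2 * k < n \<and> T k}" and ?E = "{k. 2 * k = n \<and> T k}"
    and ?U = "{k. k \<le> n \<and> 2 * k > n \<and> T k}"
  have fin: "finite ?L" "finite ?E" "finite ?U"
    by (auto intro: finite_subset [of _ "{..n}"])
  have "{k. k \<le> n \<and> T k} = ?L \<union> (?E \<union> ?U)" by auto
  then have "(\<Sum>k\<in>{k. k \<le> n \<and> T k}. p k) = sum p (?L \<union> (?E \<union> ?U))" by simp
  also have "\<dots> = sum p ?L + sum p (?E \<union> ?U)"
    using fin by (intro sum.union_disjoint) auto
  also have "sum p (?E \<union> ?U) = sum p ?E + sum p ?U"
    using fin by (intro sum.union_disjoint) auto
  also have "sum p ?U = sum p ?L"
    by (rule sum.reindex_bij_witness [of _ "\<lambda>k. n - k" "\<lambda>k. n - k"]) (auto simp: p T)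
  finally show ?thesis by simp
qed

text \<open>For \<open>h = 1\<close> the truncated difference \<open>h - 2\<close> is 0, and the
  lower bound 1 still makes the third set empty, as it should be.\<close>

lemma parity_classes_upto_odd:
  fixes h :: nat
  assumes "odd h"
  shows "{k. k < h \<and> even k} = {k. 0 \<le> k \<and> k \<le> h - 1 \<and> even k}"
    and "{k. k = h \<and> even k} = {}"
    and "{k. k < h \<and> odd k} = {k. 1 \<le> k \<and> k \<le> h - 2 \<and> odd k}"
    and "{k. k = h \<and> odd k} = {h}"
  using assms
  by (intro set_eqI; simp only: mem_Collect_eq insert_iff empty_iff; presburger)+

text \<open>An even \<open>h \<ge> 1\<close> is at least 2, so \<open>h - 2\<close> is a true
  difference. At \<open>h = 0\<close> truncation would wrongly admit \<open>k = 0\<close>.\<close>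

lemma parity_classes_upto_even:
  fixes h :: nat
  assumes "even h" "h \<ge> 1"
  shows "{k. k < h \<and> even k} = {k. 0 \<le> k \<and> k \<le> h - 2 \<and> even k}"
    and "{k. k = h \<and> even k} = {h}"
    and "{k. k < h \<and> odd k} = {k. 1 \<le> k \<and> k \<le> h - 1 \<and> odd k}"
    and "{k. k = h \<and> odd k} = {}"
  using assms
  by (intro set_eqI; simp only: mem_Collect_eq insert_iff empty_iff; presburger)+

section \<open>Symmetry, parity and mean of the number of roots in the left half plane\<close>

theorem corollary6:
  fixes M :: "'a measure" and A :: "nat \<Rightarrow> 'a \<Rightarrow> real" and n :: nat
    and X :: "'a \<Rightarrow> nat" and p :: "nat \<Rightarrow> real"
  assumes "prob_space M"
    and "n \<ge> 1"
    and "prob_space.indep_vars M (\<lambda>_. borel) A {0..n}"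
    and "\<And>i. i \<le> n \<Longrightarrow> distributed M lborel (A i) std_normal_density"
  defines "X \<equiv> \<lambda>\<omega>. num_roots_neg_Re (characteristic_poly n (\<lambda>i. A i \<omega>))"
    and "p \<equiv> \<lambda>k. \<P>(\<omega> in M. X \<omega> = k)"
  shows "prob_space.expectation M (\<lambda>\<omega>. real (X \<omega>)) = real n / 2 \<and>
    (odd n \<longrightarrow>
      2 * (\<Sum>k=0..(n - 1) div 2. p k) = 1 \<and>
      (n = 1 \<longrightarrow> p 0 = 1 / 2 \<and> p 1 = 1 / 2)) \<and>
    (even n \<longrightarrow>
      2 * (\<Sum>k=0..n div 2 - 1. p k) + p (n div 2) = 1) \<and>
    (even n \<and> even (n div 2) \<longrightarrow>
      2 * (\<Sum>k\<in>{k. 0 \<le> k \<and> k \<le> n div 2 - 2 \<and> even k}. p k) + p (n div 2) = 1 / 2 \<and>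
      2 * (\<Sum>k\<in>{k. 1 \<le> k \<and> k \<le> n div 2 - 1 \<and> odd k}. p k) = 1 / 2 \<and>
      (n = 4 \<longrightarrow> p 1 = 1 / 4 \<and> p 3 = 1 / 4 \<and> p 2 = 1 / 2 - 2 * p 0 \<and> p 4 = p 0)) \<and>
    (even n \<and> odd (n div 2) \<longrightarrow>
      2 * (\<Sum>k\<in>{k. 0 \<le> k \<and> k \<le> n div 2 - 1 \<and> even k}. p k) = 1 / 2 \<and>
      2 * (\<Sum>k\<in>{k. 1 \<le> k \<and> k \<le> n div 2 - 2 \<and> odd k}. p k) + p (n div 2) = 1 / 2 \<and>
      (n = 2 \<longrightarrow> p 0 = 1 / 4 \<and> p 2 = 1 / 4 \<and> p 1 = 1 / 2))"
proof -
  interpret prob_space M by fact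
  let ?D = "\<Pi>\<^sub>M i\<in>{0..n}. std_normal_distribution"
  let ?P = "\<Pi>\<^sub>M i\<in>{0..n}. (borel :: real measure)"
  let ?N = "\<lambda>a. num_roots_neg_Re (characteristic_poly n a)"
  let ?r = "\<lambda>i :: nat. (-1 :: real) ^ i"
  \<comment> \<open>Restriction to \<open>{0..n}\<close> makes \<open>W s\<close> a random element
    of the finite product space, where its law is \<open>?D\<close> for every sign vector
    \<open>s\<close>.\<close>
  define W where "W s \<omega> = (\<lambda>i\<in>{0..n}. s i * A i \<omega>)" for s :: "nat \<Rightarrow> real" and \<omega>
  \<comment> \<open>\<open>Y\<close> counts the roots of the original polynomial with positive real
    part. It has the law of \<open>X\<close>, because it is the same count for sign-changed
    coefficients.\<close>
  define Y where "Y \<omega> = ?N (\<lambda>i. (-1) ^ i * A i \<omega>)" for \<omega>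
  have A [measurable]: "random_variable borel (A i)" if "i \<le> n" for i
    using distributed_measurable [OF assms(4) [OF that]] by simp
  have W [measurable]: "random_variable ?P (W s)" for s
    unfolding W_def by (intro measurable_restrict) simp
  have distr_W: "distr M ?P (W s) = ?D" if "\<And>i. \<bar>s i\<bar> = 1" for s
    unfolding W_def using assms that by (intro distr_signed_std_normal_family) auto
  have coord [measurable]: "(\<lambda>a. a i) \<in> borel_measurable ?P" if "i \<le> n" for i
    using measurable_component_singleton [of i "{0..n}" "\<lambda>_. borel"] that by simp
  have N [measurable]: "?N \<in> ?P \<rightarrow>\<^sub>M count_space UNIV" by measurable
  have XY [measurable]: "X \<in> M \<rightarrow>\<^sub>M count_space UNIV" "Y \<in> M \<rightarrow>\<^sub>M count_space UNIV"
    unfolding X_def Y_def by measurable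
  have X_W: "X \<omega> = ?N (W (\<lambda>_. 1) \<omega>)" and Y_W: "Y \<omega> = ?N (W ?r \<omega>)" for \<omega>
    unfolding X_def Y_def W_def
    by (auto intro!: arg_cong [of _ _ num_roots_neg_Re] characteristic_poly_cong)
  have sign_flip: "prob {\<omega> \<in> space M. R (W s \<omega>)} = prob {\<omega> \<in> space M. R (W t \<omega>)}"
    if "\<And>i. \<bar>s i\<bar> = 1" "\<And>i. \<bar>t i\<bar> = 1" and R: "Measurable.pred ?P R" for R s t
  proof -
    have *: "prob {\<omega> \<in> space M. R (W s \<omega>)} = measure (distr M ?P (W s)) {a \<in> space ?P. R a}" for s
      using R measurable_space [OF W [of s]]
      by (subst measure_distr) (auto intro!: arg_cong [of _ _ prob])
    show ?thesis unfolding * using that by (simp add: distr_W)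
  qed
  have XY_prob: "prob {\<omega> \<in> space M. T (Y \<omega>)} = prob {\<omega> \<in> space M. T (X \<omega>)}" for T
    unfolding X_W Y_W by (intro sign_flip) (auto simp: power_abs)
  have AE_D: "AE \<omega> in M. A 0 \<omega> \<noteq> 0 \<and> A n \<omega> \<noteq> 0 \<and> X \<omega> + Y \<omega> = n"
  proof -
    have "AE a in distr M ?P (W (\<lambda>_. 1)). a 0 \<noteq> 0 \<and> a n \<noteq> 0 \<and> ?N a + ?N (\<lambda>i. (-1) ^ i * a i) = n"
      using AE_no_imaginary_root [OF assms(2)] by (subst distr_W) simp_all
    then have *: "AE \<omega> in M. W (\<lambda>_. 1) \<omega> 0 \<noteq> 0 \<and> W (\<lambda>_. 1) \<omega> n \<noteq> 0 \<and>
        ?N (W (\<lambda>_. 1) \<omega>) + ?N (\<lambda>i. (-1) ^ i * W (\<lambda>_. 1) \<omega> i) = n"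
      by (rule AE_distrD [OF W])
    have **: "?N (\<lambda>i. (-1) ^ i * W (\<lambda>_. 1) \<omega> i) = Y \<omega>" for \<omega>
      unfolding Y_def W_def
      by (auto intro!: arg_cong [of _ _ num_roots_neg_Re] characteristic_poly_cong)
    have W_1: "W (\<lambda>_. 1) \<omega> i = A i \<omega>" if "i \<le> n" for \<omega> i
      using that by (simp add: W_def)
    show ?thesis using * by eventually_elim (simp add: X_W ** W_1)
  qed
  have prob_T: "prob {\<omega> \<in> space M. T (X \<omega>)} = (\<Sum>k\<in>{k. k \<le> n \<and> T k}. p k)" for T
  proof -
    have "X \<omega> \<le> n" for \<omega>
      using num_roots_neg_Re_le_degree [of "characteristic_poly n (\<lambda>i. A i \<omega>)"]
        degree_le [of n "characteristic_poly n (\<lambda>i. A i \<omega>)"]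
      by (auto simp: X_def coeff_characteristic_poly)
    then have "{\<omega> \<in> space M. T (X \<omega>)} = (\<Union>k\<in>{k. k \<le> n \<and> T k}. {\<omega> \<in> space M. X \<omega> = k})"
      by auto
    also have "prob \<dots> = (\<Sum>k\<in>{k. k \<le> n \<and> T k}. p k)"
      unfolding p_def by (intro finite_measure_finite_Union) (auto simp: disjoint_family_on_def)
    finally show ?thesis .
  qed
  have p_sym: "p (n - k) = p k" if "k \<le> n" for k
  proof -
    \<comment> \<open>Equality in law replaces \<open>X\<close> by \<open>Y\<close>, and then
      \<open>Y = n - X\<close> almost surely.\<close>
    have "p k = prob {\<omega> \<in> space M. Y \<omega> = k}"
      unfolding p_def by (rule XY_prob [symmetric])
    also have "\<dots> = p (n - k)"
      unfolding p_def
    proof (rule finite_measure_eq_AE)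
      show "AE \<omega> in M. \<omega> \<in> {\<omega> \<in> space M. Y \<omega> = k} \<longleftrightarrow> \<omega> \<in> {\<omega> \<in> space M. X \<omega> = n - k}"
        using AE_D by eventually_elim (use that in auto)
    qed measurable
    finally show ?thesis ..
  qed
  have fold: "prob {\<omega> \<in> space M. T (X \<omega>)} =
      2 * (\<Sum>k\<in>{k. 2 * k < n \<and> T k}. p k) + (\<Sum>k\<in>{k. 2 * k = n \<and> T k}. p k)"
    if "\<And>k. k \<le> n \<Longrightarrow> T (n - k) = T k" for T
    unfolding prob_T using p_sym that by (rule sum_reflection_symmetric)

  have even_half: "prob {\<omega> \<in> space M. even (X \<omega>)} = 1 / 2"
    and odd_half: "prob {\<omega> \<in> space M. odd (X \<omega>)} = 1 / 2"
  proof -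
    \<comment> \<open>Only \<open>A 0\<close> changes sign. Since \<open>n \<ge> 1\<close>, the
      factor \<open>A n\<close> is unaffected, so the product \<open>A 0 * A n\<close> is
      negated.\<close>
    define s where "s i = (if i = 0 then - 1 else 1 :: real)" for i :: nat
    have "prob {\<omega> \<in> space M. even (Y \<omega>)} = prob {\<omega> \<in> space M. W (\<lambda>_. 1) \<omega> 0 * W (\<lambda>_. 1) \<omega> n > 0}"
    proof (rule finite_measure_eq_AE)
      show "AE \<omega> in M. \<omega> \<in> {\<omega> \<in> space M. even (Y \<omega>)} \<longleftrightarrow>
          \<omega> \<in> {\<omega> \<in> space M. W (\<lambda>_. 1) \<omega> 0 * W (\<lambda>_. 1) \<omega> n > 0}"
        using AE_D
      proof eventually_elim
        case (elim \<omega>)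
        then show ?case using constant_coeff_sign [of "\<lambda>i. A i \<omega>" n] by (simp add: Y_def W_def)
      qed
    qed measurable
    also have "\<dots> = prob {\<omega> \<in> space M. W s \<omega> 0 * W s \<omega> n > 0}"
      by (rule sign_flip) (auto simp: s_def)
    also have "\<dots> = prob {\<omega> \<in> space M. odd (Y \<omega>)}"
    proof (rule finite_measure_eq_AE)
      show "AE \<omega> in M. \<omega> \<in> {\<omega> \<in> space M. W s \<omega> 0 * W s \<omega> n > 0} \<longleftrightarrow>
          \<omega> \<in> {\<omega> \<in> space M. odd (Y \<omega>)}"
        using AE_D
      proof eventually_elim
        case (elim \<omega>)
        have "W s \<omega> 0 * W s \<omega> n = - (A 0 \<omega> * A n \<omega>)"
          using assms(2) by (simp add: W_def s_def)
        moreover have "A 0 \<omega> * A n \<omega> \<noteq> 0" using elim by simp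
        ultimately have "W s \<omega> 0 * W s \<omega> n > 0 \<longleftrightarrow> \<not> A 0 \<omega> * A n \<omega> > 0" by linarith
        then show ?case using elim constant_coeff_sign [of "\<lambda>i. A i \<omega>" n] by (simp add: Y_def)
      qed
    qed measurable
    \<comment> \<open>Passing from \<open>Y\<close> back to \<open>X\<close> by equality in law,
      rather than by \<open>X + Y = n\<close>, makes the argument uniform in the parity of
      \<open>n\<close>.\<close>
    finally have "prob {\<omega> \<in> space M. even (X \<omega>)} = prob {\<omega> \<in> space M. odd (X \<omega>)}"
      using XY_prob [of even] XY_prob [of odd] by simp
    moreover have "prob {\<omega> \<in> space M. odd (X \<omega>)} = 1 - prob {\<omega> \<in> space M. even (X \<omega>)}"
      by (rule prob_neg) measurable
    ultimately show "prob {\<omega> \<in> space M. even (X \<omega>)} = 1 / 2"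
      "prob {\<omega> \<in> space M. odd (X \<omega>)} = 1 / 2" by linarith+
  qed

  have expectation: "expectation (\<lambda>\<omega>. real (X \<omega>)) = real n / 2"
  proof -
    have sum: "AE \<omega> in M. X \<omega> + Y \<omega> = n" using AE_D by simp
    have rv: "random_variable borel (\<lambda>\<omega>. real (X \<omega>))" "random_variable borel (\<lambda>\<omega>. real (Y \<omega>))"
      by (rule measurable_compose [OF XY(1)], simp) (rule measurable_compose [OF XY(2)], simp)
    have law: "expectation (\<lambda>\<omega>. real (?N (W s \<omega>))) = integral\<^sup>L ?D (\<lambda>a. real (?N a))"
      if "\<And>i. \<bar>s i\<bar> = 1" for s
      unfolding distr_W [of s, OF that, symmetric]
      by (rule integral_distr [OF W, symmetric]) (rule measurable_compose [OF N], simp)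
    have "expectation (\<lambda>\<omega>. real (Y \<omega>)) = expectation (\<lambda>\<omega>. real (X \<omega>))"
      unfolding X_W Y_W by (simp add: law power_abs)
    \<comment> \<open>Both counts are almost surely at most \<open>n\<close>, hence integrable.
      Equal means with sum \<open>n\<close> are each \<open>n / 2\<close>.\<close>
    moreover have "expectation (\<lambda>\<omega>. real (X \<omega>)) + expectation (\<lambda>\<omega>. real (Y \<omega>)) =
        expectation (\<lambda>\<omega>. real (X \<omega>) + real (Y \<omega>))"
    proof (rule Bochner_Integration.integral_add [symmetric])
      have "AE \<omega> in M. norm (real (X \<omega>)) \<le> real n" "AE \<omega> in M. norm (real (Y \<omega>)) \<le> real n"
        using sum by (auto elim!: eventually_mono)
      from integrable_const_bound [OF this(1) rv(1)] integrable_const_bound [OF this(2) rv(2)]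
      show "integrable M (\<lambda>\<omega>. real (X \<omega>))" "integrable M (\<lambda>\<omega>. real (Y \<omega>))" .
    qed
    moreover have "expectation (\<lambda>\<omega>. real (X \<omega>) + real (Y \<omega>)) = expectation (\<lambda>\<omega>. real n)"
      using sum rv
      by (intro integral_cong_AE borel_measurable_add) (auto elim!: eventually_mono)
    ultimately show ?thesis by (simp add: prob_space)
  qed

  have total: "2 * (\<Sum>k\<in>{k. 2 * k < n}. p k) + (\<Sum>k\<in>{k. 2 * k = n}. p k) = 1"
    using fold [of "\<lambda>_. True"] by (simp add: prob_space)
  have odd_case: "2 * (\<Sum>k=0..(n - 1) div 2. p k) = 1" if "odd n"
  proof -
    have "{k. 2 * k < n} = {0..(n - 1) div 2}" "{k. 2 * k = n} = {}"
      using that by (intro set_eqI; simp only: mem_Collect_eq atLeastAtMost_iff insert_iff empty_iff; presburger)+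
    then show ?thesis using total by simp
  qed
  have even_case: "2 * (\<Sum>k=0..n div 2 - 1. p k) + p (n div 2) = 1" if "even n"
  proof -
    \<comment> \<open>Here \<open>n\<close> is even and positive, so \<open>n div 2 - 1\<close> is
      not truncated.\<close>
    have "{k. 2 * k < n} = {0..n div 2 - 1}" "{k. 2 * k = n} = {n div 2}"
      using that assms(2) by (intro set_eqI; simp only: mem_Collect_eq atLeastAtMost_iff insert_iff empty_iff; presburger)+
    then show ?thesis using total by simp
  qed
  have parity: "2 * (\<Sum>k\<in>{k. k < n div 2 \<and> even k}. p k) + (\<Sum>k\<in>{k. k = n div 2 \<and> even k}. p k) = 1 / 2"
    "2 * (\<Sum>k\<in>{k. k < n div 2 \<and> odd k}. p k) + (\<Sum>k\<in>{k. k = n div 2 \<and> odd k}. p k) = 1 / 2"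
    if "even n"
  proof -
    have half: "k < n div 2 \<longleftrightarrow> 2 * k < n" "k = n div 2 \<longleftrightarrow> 2 * k = n" for k
      using that by auto
    show "2 * (\<Sum>k\<in>{k. k < n div 2 \<and> even k}. p k) + (\<Sum>k\<in>{k. k = n div 2 \<and> even k}. p k) = 1 / 2"
      "2 * (\<Sum>k\<in>{k. k < n div 2 \<and> odd k}. p k) + (\<Sum>k\<in>{k. k = n div 2 \<and> odd k}. p k) = 1 / 2"
      unfolding half using fold [of even] fold [of odd] even_half odd_half that by simp_all
  qed
  have four_dvd: "2 * (\<Sum>k\<in>{k. 0 \<le> k \<and> k \<le> n div 2 - 2 \<and> even k}. p k) + p (n div 2) = 1 / 2"
    "2 * (\<Sum>k\<in>{k. 1 \<le> k \<and> k \<le> n div 2 - 1 \<and> odd k}. p k) = 1 / 2"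
    if "even n" "even (n div 2)"
  proof -
    have "n div 2 \<ge> 1" using that assms(2) by auto
    then show "2 * (\<Sum>k\<in>{k. 0 \<le> k \<and> k \<le> n div 2 - 2 \<and> even k}. p k) + p (n div 2) = 1 / 2"
      "2 * (\<Sum>k\<in>{k. 1 \<le> k \<and> k \<le> n div 2 - 1 \<and> odd k}. p k) = 1 / 2"
      using parity [OF that(1)] unfolding parity_classes_upto_even [OF that(2) \<open>n div 2 \<ge> 1\<close>] by simp_all
  qed
  have not_four_dvd: "2 * (\<Sum>k\<in>{k. 0 \<le> k \<and> k \<le> n div 2 - 1 \<and> even k}. p k) = 1 / 2"
    "2 * (\<Sum>k\<in>{k. 1 \<le> k \<and> k \<le> n div 2 - 2 \<and> odd k}. p k) + p (n div 2) = 1 / 2"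
    if "even n" "odd (n div 2)"
    using parity [OF that(1)] unfolding parity_classes_upto_odd [OF that(2)] by simp_all
  have one: "p 0 = 1 / 2 \<and> p 1 = 1 / 2" if "n = 1"
    using odd_case p_sym [of 0] that by simp
  have four: "p 1 = 1 / 4 \<and> p 3 = 1 / 4 \<and> p 2 = 1 / 2 - 2 * p 0 \<and> p 4 = p 0" if "n = 4"
  proof -
    have "{k :: nat. 0 \<le> k \<and> k \<le> 4 div 2 - 2 \<and> even k} = {0}"
      "{k :: nat. 1 \<le> k \<and> k \<le> 4 div 2 - 1 \<and> odd k} = {1}"
      by (auto intro: le_antisym)
    then show ?thesis using four_dvd p_sym [of 0] p_sym [of 1] that by simp
  qed
  have two: "p 0 = 1 / 4 \<and> p 2 = 1 / 4 \<and> p 1 = 1 / 2" if "n = 2"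
  proof -
    have sets: "{k :: nat. 0 \<le> k \<and> k \<le> 2 div 2 - 1 \<and> even k} = {0}"
      "{k :: nat. 1 \<le> k \<and> k \<le> 2 div 2 - 2 \<and> odd k} = {}"
      by auto
    show ?thesis using not_four_dvd p_sym [of 0] unfolding that sets by simp
  qed
  show ?thesis
    using expectation odd_case even_case four_dvd not_four_dvd one two four by blast
qed

end
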